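(* Let $X$ be a Banach space and $X_1,X_2$ closed subspaces of $X$ such that $X=X_1\oplus X_2$. Assume that there exist $r>0$ and functions $\theta,\tilde\theta\colon B_r^{X_1}(0)\to X_2$, $\sigma,\tilde\sigma\colon B_r^{X_2}(0)\to X_1$ with $\theta(0)=\sigma(0)=0$, ${\rm Lip}(\theta)<1$ and ${\rm Lip}(\sigma)<1$. Define the sets $$M=\{y+\theta(y)\colon y\in B_r^{X_1}(0)\},\qquad N=\{\sigma(x)+x\colon x\in B_r^{X_2}(0)\},$$ $$\tilde M=\{z+y+\tilde\theta(y)\colon y\in B_r^{X_1}(0)\},\qquad \tilde N=\{z+\tilde\sigma(x)+x\colon x\in B_r^{X_2}(0)\},$$ where $z\in X$, and suppose also that there exists $0<c<1$ such that ${\rm Lip}(\theta)\leqslant c$, ${\rm Lip}(\sigma)\leqslant c$ and $$\|\theta(y)-\tilde\theta(y)\|\leqslant(1-c)\tfrac r2\ \text{ and }\ \|\sigma(x)-\tilde\sigma(x)\|\leqslant(1-c)\tfrac r2\quad\text{for all } y\in B_r^{X_1}(0),\ x\in B_r^{X_2}(0).$$ (a) If $\dim X_1<\infty$ or ${\rm Lip}(\tilde\theta)\cdot{\rm Lip}(\tilde\sigma)<1$, then $\tilde M\cap\tilde N\neq\varnothing$. (b) If ${\rm Lip}(\tilde\theta)<1$ and ${\rm Lip}(\tilde\sigma)<1$, then there exists a point $y_0$ such that $\tilde M$ and $\tilde N$ are $\mathfrak L$-transversal at $y_0$, i.e. $\tilde M\pitchfork_{\mathfrak L,y_0}\tilde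 N$.
   Context: $B_r^{Y}(0)$ is the open ball of radius $r$ about $0$ in $Y$; for a Lipschitz map, ${\rm Lip}(\cdot)$ denotes any Lipschitz constant of the map (on its domain). $\mathfrak L$-transversality: for subsets $A,B$ of a Banach space $X$ and $x_0\in A\cap B$, $A$ and $B$ are $\mathfrak L$-transversal at $x_0$ (written $A\pitchfork_{\mathfrak L,x_0}B$) if there exist closed vector subspaces $Y_1,Y_2\subset X$ with $X=Y_1\oplus Y_2$, a real number $\rho>0$ and two Lipschitz continuous functions $\alpha\colon B_\rho^{Y_1}(0)\to Y_2$, $\beta\colon B_\rho^{Y_2}(0)\to Y_1$ with $\alpha(0)=\beta(0)=0$, ${\rm Lip}(\alpha)<1$, ${\rm Lip}(\beta)<1$ and $\{x_0+\xi+\alpha(\xi):\xi\in B_\rho^{Y_1}(0)\}\subseteq A$, $\{x_0+\beta(\eta)+\eta:\eta\in B_\rho^{Y_2}(0)\}\subseteq B$.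
   Formalization: In (a), for the alternative dim X_1 < ∞, the functions θ̃ and σ̃ are additionally assumed continuous on their balls; for arbitrary functions the claim fails, already in the plane. *)

theory Defs
  imports "HOL-Analysis.Analysis"
begin

definition closed_complements :: "'a::real_normed_vector set \<Rightarrow> 'a set \<Rightarrow> bool" where
  "closed_complements Y1 Y2 \<longleftrightarrow>
     subspace Y1 \<and> closed Y1 \<and> subspace Y2 \<and> closed Y2 \<and>
     {y1 + y2 | y1 y2. y1 \<in> Y1 \<and> y2 \<in> Y2} = UNIV \<and> Y1 \<inter> Y2 = {0}"

text \<open>The library function \<^const>\<open>dim\<close> is 0 on infinite-dimensional subspaces, so finiteness of
  the dimension is stated through a finite spanning set.\<close>

definition finite_dim :: "'a::real_vector set \<Rightarrow> bool" where
  "finite_dim Y \<longleftrightarrow> (\<exists>B. finite B \<and> span B = Y)"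

text \<open>A map between subsets of a space is represented by a function on the whole type; only its
  values on the stated domain matter.\<close>

definition subspace_ball :: "'a::real_normed_vector set \<Rightarrow> real \<Rightarrow> 'a set" where
  "subspace_ball Y r = {y \<in> Y. norm y < r}"

definition L_transversal :: "'a::banach set \<Rightarrow> 'a set \<Rightarrow> 'a \<Rightarrow> bool" where
  "L_transversal A B x0 \<longleftrightarrow> x0 \<in> A \<inter> B \<and>
     (\<exists>Y1 Y2 \<rho> \<alpha> \<beta>. closed_complements Y1 Y2 \<and> \<rho> > 0 \<and>
        \<alpha> \<in> subspace_ball Y1 \<rho> \<rightarrow> Y2 \<and> \<beta> \<in> subspace_ball Y2 \<rho> \<rightarrow> Y1 \<and>
        \<alpha> 0 = 0 \<and> \<beta> 0 = 0 \<and>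
        (\<exists>L<1. L-lipschitz_on (subspace_ball Y1 \<rho>) \<alpha>) \<and>
        (\<exists>L<1. L-lipschitz_on (subspace_ball Y2 \<rho>) \<beta>) \<and>
        {x0 + \<xi> + \<alpha> \<xi> | \<xi>. \<xi> \<in> subspace_ball Y1 \<rho>} \<subseteq> A \<and>
        {x0 + \<beta> \<eta> + \<eta> | \<eta>. \<eta> \<in> subspace_ball Y2 \<rho>} \<subseteq> B)"

end

theory Submission
  imports Defs
begin

text \<open>Let \<open>r\<close> be the radius of the domains and \<open>c\<close> the common Lipschitz bound of the unperturbed
  maps \<open>\<theta>\<close>, \<open>\<sigma>\<close>. The sets \<open>z + graph \<theta>t\<close> and \<open>z + graph \<sigma>t\<close> meet as soon as \<open>x = \<theta>t y\<close> and
  \<open>y = \<sigma>t x\<close> for some \<open>y\<close>, \<open>x\<close> in the domains, that is, as soon as \<open>\<sigma>t \<circ> \<theta>t\<close> has a fixed point;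
  the translation by \<open>z\<close> is common to both graphs and cancels. The point of the smallness condition
  is that \<open>norm y \<le> r / 2\<close> implies
  \<open>norm (\<theta>t y) \<le> c * (r / 2) + (1 - c) * (r / 2) = r / 2\<close>,
  and likewise for \<open>\<sigma>t\<close> (\<open>perturbed_graph_half_ball\<close>). Hence \<open>\<sigma>t \<circ> \<theta>t\<close> maps the closed ball \<open>K\<close> of
  radius \<open>r / 2\<close> in \<open>X1\<close> into itself, and this ball lies well inside the open ball of radius \<open>r\<close>
  on which everything is defined.

  If the product of the Lipschitz constants is less than 1, the fixed point comes from the Banach
  contraction principle on the complete set \<open>K\<close>. If \<open>X1\<close> is finite-dimensional and the perturbed
  maps are continuous, \<open>K\<close> is compact (\<open>compact_ball_span\<close>) and convex, and Schauder's theorem (\<open>schauder_fixed_point\<close>) applies.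
  Because the dimension of \<open>X1\<close> is not the dimension of a type, Brouwer's theorem is needed for
  cubes whose dimension is a natural number (\<open>brouwer_nat_cube\<close>); it follows from
  Kuhn's combinatorial lemma.

  When both perturbed maps have Lipschitz constants less than 1, the product is less than 1, so there
  is a common point \<open>z + y + x\<close>. The same splitting \<open>X1\<close>, \<open>X2\<close>, with both maps
  recentred at that point, witnesses transversality (\<open>L_transversal_at_common_point\<close>).\<close>

section \<open>Brouwer's theorem for cubes of arbitrary finite dimension\<close>

text \<open>The coordinates from \<open>n\<close> on are set to 0, which makes the cube a compact subset of the
  product space \<open>nat \<Rightarrow> real\<close>.\<close>
definition nat_cube :: "nat \<Rightarrow> (nat \<Rightarrow> real) set" where
  "nat_cube n = {t. (\<forall>i<n. 0 \<le> t i \<and> t i \<le> 1) \<and> (\<forall>i\<ge>n. t i = 0)}"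

text \<open>On the grid of mesh \<open>1 / p\<close>, label a coordinate of a grid point 0 where \<open>G\<close> does not decrease
  it and 1 where \<open>G\<close> does not increase it; the faces of the cube get the labels that Kuhn's lemma
  requires, as \<open>G\<close> maps into the cube. Kuhn's lemma then yields a grid cell such that each
  coordinate has both labels among the vertices of the cell. Since \<open>G\<close> hardly varies on the cell, it
  almost fixes each coordinate of the lowest vertex.\<close>
lemma approximate_fixed_point_cube:
  fixes G :: "(nat \<Rightarrow> real) \<Rightarrow> nat \<Rightarrow> real" and n :: nat and \<delta> \<epsilon> :: real
  assumes "\<delta> > 0" and G: "G \<in> nat_cube n \<rightarrow> nat_cube n"
    and mod: "\<And>s t i. s \<in> nat_cube n \<Longrightarrow> t \<in> nat_cube n \<Longrightarrow> (\<And>j. j < n \<Longrightarrow> \<bar>s j - t j\<bar> \<le> \<delta>) \<Longrightarrow> i < n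
                \<Longrightarrow> \<bar>G s i - G t i\<bar> \<le> \<epsilon>"
  obtains t where "t \<in> nat_cube n" "\<And>i. i < n \<Longrightarrow> \<bar>G t i - t i\<bar> \<le> \<epsilon> + \<delta>"
proof -
  obtain p :: nat where p: "p > 0" "1 / real p \<le> \<delta>"
    by (metis \<open>\<delta> > 0\<close> less_imp_le nat_approx_posE zero_less_Suc)
  define pt where "pt x = (\<lambda>i. if i < n then real (x i) / real p else 0)" for x :: "nat \<Rightarrow> nat"
  have ptC: "pt x \<in> nat_cube n" if "\<forall>i<n. x i \<le> p" for x
    using that p by (auto simp: pt_def nat_cube_def)
  have GC: "0 \<le> G (pt x) i" "G (pt x) i \<le> 1" if "\<forall>i<n. x i \<le> p" "i < n" for x i
    using G ptC[OF that(1)] that(2) by (auto simp: nat_cube_def Pi_iff)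
  \<comment> \<open>The label of a coordinate that is fixed by \<open>G\<close> is free, except on the two faces.\<close>
  define label :: "(nat \<Rightarrow> nat) \<Rightarrow> nat \<Rightarrow> nat" where
    "label x i = (if x i = 0 \<or> x i \<noteq> p \<and> pt x i \<le> G (pt x) i then 0 else 1)" for x i
  have label0: "pt x i \<le> G (pt x) i" if "label x i = 0" "\<forall>i<n. x i \<le> p" "i < n" for x i
    using that GC[OF that(2,3)] by (auto simp: label_def pt_def split: if_splits)
  have label1: "G (pt x) i \<le> pt x i" if "label x i \<noteq> 0" "\<forall>i<n. x i \<le> p" "i < n" for x i
    using that GC[OF that(2,3)] p by (auto simp: label_def pt_def split: if_splits)
  obtain q where q: "\<forall>i<n. q i < p"
    "\<forall>i<n. \<exists>r s. (\<forall>j<n. q j \<le> r j \<and> r j \<le> q j + 1) \<and> (\<forall>j<n. q j \<le> s j \<and> s j \<le> q j + 1) \<and>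
       label r i \<noteq> label s i"
    by (rule kuhn_lemma[of p n label]) (use p in \<open>auto simp: label_def\<close>)
  have qp: "\<forall>i<n. q i \<le> p" using q(1) by auto
  have step: "x j \<le> p" "pt q j \<le> pt x j" "pt x j \<le> pt q j + \<delta>"
    if "\<forall>j<n. q j \<le> x j \<and> x j \<le> q j + 1" "j < n" for x j
  proof -
    have j: "q j \<le> x j" "x j \<le> q j + 1" "q j < p" using that q(1) by auto
    show "x j \<le> p" using j by auto
    show "pt q j \<le> pt x j" using j that by (auto simp: pt_def divide_right_mono)
    have "real (x j) / real p \<le> (real (q j) + 1) / real p"
      using j by (intro divide_right_mono) auto
    then show "pt x j \<le> pt q j + \<delta>" using p that by (auto simp: pt_def add_divide_distrib)
  qed
  have near: "\<bar>G (pt x) i - G (pt q) i\<bar> \<le> \<epsilon>" if "\<forall>j<n. q j \<le> x j \<and> x j \<le> q j + 1" "i < n" for x i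
  proof (rule mod[OF ptC ptC[OF qp] _ that(2)])
    show "\<forall>i<n. x i \<le> p" using step(1)[OF that(1)] by blast
    show "\<bar>pt x j - pt q j\<bar> \<le> \<delta>" if "j < n" for j
      using step(2,3)[OF \<open>\<forall>j<n. q j \<le> x j \<and> x j \<le> q j + 1\<close> that] by auto
  qed
  have "\<bar>G (pt q) i - pt q i\<bar> \<le> \<epsilon> + \<delta>" if i: "i < n" for i
  proof -
    obtain r s where rs: "\<forall>j<n. q j \<le> r j \<and> r j \<le> q j + 1" "\<forall>j<n. q j \<le> s j \<and> s j \<le> q j + 1"
      "label r i = 0" "label s i \<noteq> 0"
    proof -
      obtain u v where uv: "\<forall>j<n. q j \<le> u j \<and> u j \<le> q j + 1" "\<forall>j<n. q j \<le> v j \<and> v j \<le> q j + 1"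
        "label u i \<noteq> label v i"
        using q(2) i by blast
      then have "label u i = 0 \<and> label v i \<noteq> 0 \<or> label v i = 0 \<and> label u i \<noteq> 0"
        by (auto simp: label_def split: if_splits)
      with uv(1,2) show ?thesis using that by blast
    qed
    have "pt r i \<le> G (pt r) i" using label0[OF rs(3) _ i] step(1)[OF rs(1)] by blast
    moreover have "G (pt s) i \<le> pt s i" using label1[OF rs(4) _ i] step(1)[OF rs(2)] by blast
    ultimately show ?thesis
      using near[OF rs(1) i] near[OF rs(2) i] step(2,3)[OF rs(1) i] step(2,3)[OF rs(2) i] \<open>\<delta> > 0\<close>
      by linarith
  qed
  with ptC[OF qp] show ?thesis using that by blast
qed

text \<open>By uniform continuity the total displacement \<open>\<Sum>i<n. \<bar>G t i - t i\<bar>\<close> is arbitrarily small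
  somewhere on the cube; by compactness it attains its infimum, which is therefore 0.\<close>
lemma brouwer_nat_cube:
  fixes G :: "(nat \<Rightarrow> real) \<Rightarrow> nat \<Rightarrow> real" and n :: nat
  assumes cont: "continuous_on (nat_cube n) G" and G: "G \<in> nat_cube n \<rightarrow> nat_cube n"
  obtains t where "t \<in> nat_cube n" "G t = t"
proof -
  have "nat_cube n = PiE UNIV (\<lambda>i. if i < n then {0..1::real} else {0})"
  proof (intro equalityI subsetI)
    fix t assume t: "t \<in> PiE UNIV (\<lambda>i. if i < n then {0..1::real} else {0})"
    then have "t i \<in> (if i < n then {0..1} else {0})" for i by (rule PiE_mem) simp
    then show "t \<in> nat_cube n" unfolding nat_cube_def by (smt (verit) mem_Collect_eq atLeastAtMost_iff singletonD not_less)
  qed (auto simp: nat_cube_def)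
  moreover have "compactin (product_topology (\<lambda>i::nat. euclidean) UNIV)
      (PiE UNIV (\<lambda>i. if i < n then {0..1::real} else {0}))"
    by (auto simp: compactin_PiE)
  ultimately have comp: "compact (nat_cube n)"
    by (simp add: euclidean_product_topology)
  \<comment> \<open>The metric of the product space is a sum weighted by the powers of \<open>1 / 2\<close>, whose total is 2.\<close>
  have close: "dist s t \<le> 2 * \<delta>" if "s \<in> nat_cube n" "t \<in> nat_cube n" "\<And>j. j < n \<Longrightarrow> \<bar>s j - t j\<bar> \<le> \<delta>" "\<delta> > 0" for s t \<delta>
  proof -
    have "\<bar>s j - t j\<bar> \<le> \<delta>" for j using that by (cases "j < n") (auto simp: nat_cube_def not_less)
    then have le: "(1/2)^k * min (dist (s (from_nat k)) (t (from_nat k))) 1 \<le> (1/2)^k * \<delta>" for k :: nat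
      by (intro mult_left_mono) (auto simp: dist_real_def min_le_iff_disj)
    have "dist s t \<le> (\<Sum>k. (1/2)^k * \<delta>)"
      unfolding dist_fun_def
    proof (rule suminf_le[OF le])
      show "summable (\<lambda>k. (1/2)^k * min (dist (s (from_nat k)) (t (from_nat k))) 1)"
        by (rule summable_comparison_test'[of "\<lambda>k. (1/2)^k"]) (simp_all add: summable_geometric)
      show "summable (\<lambda>k. (1/2)^k * \<delta>)"
        by (intro summable_mult2 summable_geometric) simp
    qed
    also have "\<dots> = 2 * \<delta>"
      using suminf_mult2[OF summable_geometric[of "1/2::real"], of \<delta>]
        suminf_geometric[of "1/2::real"] by simp
    finally show ?thesis .
  qed
  have Gi: "continuous_on (nat_cube n) (\<lambda>t. G t i)" for i
    using cont by (rule continuous_on_product_then_coordinatewise)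
  have small: "\<exists>t\<in>nat_cube n. (\<Sum>i<n. \<bar>G t i - t i\<bar>) \<le> e" if "e > 0" for e
  proof -
    define \<epsilon> where "\<epsilon> = e / (2 * (real n + 1))"
    have \<epsilon>: "\<epsilon> > 0" using that by (auto simp: \<epsilon>_def)
    have "\<exists>d>0. \<forall>s\<in>nat_cube n. \<forall>t\<in>nat_cube n. dist s t < d \<longrightarrow> \<bar>G s i - G t i\<bar> < \<epsilon>" for i
      using compact_uniformly_continuous[OF Gi comp, of i] \<epsilon>
      unfolding uniformly_continuous_on_def dist_real_def by (metis dist_commute)
    then obtain d where d: "\<And>i. d i > 0"
      "\<And>i s t. s \<in> nat_cube n \<Longrightarrow> t \<in> nat_cube n \<Longrightarrow> dist s t < d i \<Longrightarrow> \<bar>G s i - G t i\<bar> < \<epsilon>"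
      by metis
    define D where "D = Min (insert \<epsilon> (d ` {..<n}))"
    have D: "D > 0" "D \<le> \<epsilon>" "\<And>i. i < n \<Longrightarrow> D \<le> d i"
      using d(1) \<epsilon> by (auto simp: D_def)
    obtain t where t: "t \<in> nat_cube n" "\<And>i. i < n \<Longrightarrow> \<bar>G t i - t i\<bar> \<le> \<epsilon> + D / 3"
    proof (rule approximate_fixed_point_cube[of "D / 3" G n \<epsilon>])
      fix s t i assume st: "s \<in> nat_cube n" "t \<in> nat_cube n" "\<And>j. j < n \<Longrightarrow> \<bar>s j - t j\<bar> \<le> D / 3" "i < n"
      have "dist s t \<le> 2 * (D / 3)" using st D by (intro close) auto
      also have "\<dots> < d i" using D(1) D(3)[OF st(4)] by linarith
      finally show "\<bar>G s i - G t i\<bar> \<le> \<epsilon>" using d(2) st by (meson less_imp_le)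
    qed (use D G in auto)
    have "(\<Sum>i<n. \<bar>G t i - t i\<bar>) \<le> (\<Sum>i<n. 2 * \<epsilon>)"
      using t(2) D(1,2) by (intro sum_mono) fastforce
    also have "\<dots> \<le> e" using that by (auto simp: \<epsilon>_def field_simps)
    finally show ?thesis using t(1) by blast
  qed
  have ne: "nat_cube n \<noteq> {}" by (auto simp: nat_cube_def intro!: exI[of _ "\<lambda>_. 0"])
  have "continuous_on (nat_cube n) (\<lambda>t. \<Sum>i<n. \<bar>G t i - t i\<bar>)"
    by (intro continuous_intros Gi continuous_on_subset[OF continuous_on_product_coordinates]) auto
  from continuous_attains_inf[OF comp ne this]
  obtain t where t: "t \<in> nat_cube n"
    "\<And>s. s \<in> nat_cube n \<Longrightarrow> (\<Sum>i<n. \<bar>G t i - t i\<bar>) \<le> (\<Sum>i<n. \<bar>G s i - s i\<bar>)"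
    by blast
  have "(\<Sum>i<n. \<bar>G t i - t i\<bar>) \<le> 0"
  proof (rule dense_ge)
    fix e :: real assume "0 < e"
    then show "(\<Sum>i<n. \<bar>G t i - t i\<bar>) \<le> e" using small t(2) by (meson order_trans)
  qed
  then have "(\<Sum>i<n. \<bar>G t i - t i\<bar>) = 0" by (simp add: sum_nonneg antisym)
  then have "G t i = t i" if "i < n" for i using that by (simp add: sum_nonneg_eq_0_iff)
  moreover have "G t i = t i" if "\<not> i < n" for i using that G t(1) by (auto simp: nat_cube_def Pi_iff)
  ultimately have "G t = t" by blast
  with t(1) show ?thesis using that by blast
qed

section \<open>Schauder's fixed point theorem\<close>

text \<open>Take a finite \<open>e\<close>-net \<open>a\<close> of \<open>K\<close>. The Schauder projection replaces a point \<open>y\<close> of \<open>K\<close> by the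
  average of the net points within distance \<open>e\<close> of \<open>y\<close>, with the weights \<open>w i y / W y\<close>, and moves \<open>y\<close>
  by at most \<open>e\<close>. Following \<open>F\<close> by this projection gives a finite-dimensional problem about the vector
  of weights, and Brouwer's theorem for it yields an \<open>e\<close>-fixed point of \<open>F\<close>. Compactness of \<open>K\<close>
  turns approximate fixed points into an exact one.\<close>
theorem schauder_fixed_point:
  fixes K :: "'a::real_normed_vector set"
  assumes K: "compact K" "convex K" "K \<noteq> {}"
    and F: "continuous_on K F" "F \<in> K \<rightarrow> K"
  obtains x where "x \<in> K" "F x = x"
proof -
  have small: "\<exists>x\<in>K. norm (F x - x) \<le> e" if e: "e > 0" for e
  proof -
    obtain A where A: "finite A" "A \<subseteq> K" "K \<subseteq> (\<Union>a\<in>A. ball a e)"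
      using seq_compact_imp_totally_bounded[of K] K(1) e by (meson compact_imp_seq_compact)
    obtain a n where a: "A = a ` {..<n::nat}" using A(1) by (metis finite_conv_nat_seg_image lessThan_def)
    have "n > 0" using A K a by (cases n) auto
    have aK: "a i \<in> K" if "i < n" for i using A a that by auto
    define w where "w i y = max 0 (e - norm (y - a i))" for i y
    define W where "W y = (\<Sum>i<n. w i y)" for y
    have w0: "w i y \<ge> 0" for i y by (auto simp: w_def)
    have W: "W y > 0" if y: "y \<in> K" for y
    proof -
      obtain i where i: "i < n" "dist (a i) y < e" using A(3) y a by (auto simp: subset_iff)
      then have "0 < w i y" by (auto simp: w_def dist_norm norm_minus_commute)
      also have "\<dots> \<le> W y" unfolding W_def by (rule member_le_sum) (use i w0 in auto)
      finally show ?thesis .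
    qed
    have wW: "w i y \<le> W y" if "i < n" for i y
      unfolding W_def by (rule member_le_sum) (use that w0 in auto)
    \<comment> \<open>Brouwer's theorem is available on the whole cube, whereas weights live on the simplex:
      \<open>u\<close> is a retraction of the cube onto the simplex. A missing amount of weight goes to the point
      \<open>a 0\<close>, an excess is scaled away, so no division by 0 occurs at the origin.\<close>
    define u where "u t i = (if i = 0 then t i + max 0 (1 - sum t {..<n}) else t i) / max 1 (sum t {..<n})"
      for t :: "nat \<Rightarrow> real" and i
    define \<psi> where "\<psi> t = (\<Sum>i<n. u t i *\<^sub>R a i)" for t
    have \<psi>K: "\<psi> t \<in> K" if "t \<in> nat_cube n" for t
      unfolding \<psi>_def
    proof (rule convex_sum)
      have "sum (\<lambda>i. if i = 0 then t i + max 0 (1 - sum t {..<n}) else t i) {..<n}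
         = sum (\<lambda>i. t i + (if i = 0 then max 0 (1 - sum t {..<n}) else 0)) {..<n}"
        by (rule sum.cong) auto
      also have "\<dots> = max 1 (sum t {..<n})" using \<open>n > 0\<close> by (auto simp: sum.distrib)
      finally show "sum (u t) {..<n} = 1"
        by (simp add: u_def flip: sum_divide_distrib)
      show "u t i \<ge> 0" if "i \<in> {..<n}" for i
        using \<open>t \<in> nat_cube n\<close> that by (auto simp: u_def nat_cube_def intro!: divide_nonneg_pos)
    qed (use K aK in auto)
    define G where "G t i = (if i < n then w i (F (\<psi> t)) / W (F (\<psi> t)) else 0)" for t i
    have FK: "F (\<psi> t) \<in> K" if "t \<in> nat_cube n" for t using \<psi>K[OF that] F(2) by auto
    have GC: "G \<in> nat_cube n \<rightarrow> nat_cube n"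
    proof
      fix t assume "t \<in> nat_cube n"
      then have "W (F (\<psi> t)) > 0" using W FK by blast
      then show "G t \<in> nat_cube n" using w0 wW by (simp add: nat_cube_def G_def)
    qed
    have coord: "continuous_on (nat_cube n) (\<lambda>t. t i)" for i
      by (rule continuous_on_subset[OF continuous_on_product_coordinates]) auto
    have "continuous_on (nat_cube n) (\<lambda>t. u t i)" for i
      unfolding u_def by (cases "i = 0") (auto intro!: continuous_intros coord)
    then have "continuous_on (nat_cube n) \<psi>"
      unfolding \<psi>_def by (intro continuous_intros)
    then have F\<psi>: "continuous_on (nat_cube n) (\<lambda>t. F (\<psi> t))"
      by (rule continuous_on_compose2[OF F(1)]) (use \<psi>K in auto)
    have "continuous_on (nat_cube n) G"
    proof (rule continuous_on_coordinatewise_then_product)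
      fix i
      show "continuous_on (nat_cube n) (\<lambda>t. G t i)"
      proof (cases "i < n")
        case True
        have "continuous_on (nat_cube n) (\<lambda>t. w i (F (\<psi> t)) / W (F (\<psi> t)))"
          using W[OF FK] unfolding w_def W_def by (intro continuous_intros F\<psi>) (auto simp: less_le)
        then show ?thesis using True by (simp add: G_def)
      qed (simp add: G_def)
    qed
    then obtain t where t: "t \<in> nat_cube n" "G t = t"
      using GC brouwer_nat_cube[of n G] by blast
    define y where "y = F (\<psi> t)"
    have y: "y \<in> K" "W y > 0" using FK[OF t(1)] W by (auto simp: y_def)
    have ti: "t i = w i y / W y" if "i < n" for i
      using that t(2) by (metis G_def y_def)
    \<comment> \<open>The fixed point lies on the simplex, where the retraction is the identity.\<close>
    have sum1: "sum t {..<n} = 1"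
      using ti y(2) by (simp add: W_def flip: sum_divide_distrib)
    have "\<psi> t = (\<Sum>i<n. t i *\<^sub>R a i)"
      unfolding \<psi>_def u_def sum1 by (intro sum.cong) auto
    then have "y - \<psi> t = (\<Sum>i<n. t i *\<^sub>R (y - a i))"
      using sum1 by (simp add: scaleR_diff_right sum_subtractf flip: scaleR_left.sum)
    also have "norm \<dots> \<le> (\<Sum>i<n. t i * e)"
    proof (rule sum_norm_le)
      fix i assume "i \<in> {..<n}"
      then have i: "i < n" "t i \<ge> 0" using t(1) by (auto simp: nat_cube_def)
      show "norm (t i *\<^sub>R (y - a i)) \<le> t i * e"
      proof (cases "norm (y - a i) \<le> e")
        case False
        then have "t i = 0" using ti[OF i(1)] by (simp add: w_def)
        then show ?thesis by simp
      qed (use i in \<open>auto intro: mult_left_mono\<close>)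
    qed
    also have "\<dots> = e" using sum1 by (simp flip: sum_distrib_right)
    finally show ?thesis using \<psi>K[OF t(1)] by (auto simp: y_def)
  qed
  have "continuous_on K (\<lambda>x. norm (F x - x))" by (intro continuous_intros F)
  from continuous_attains_inf[OF K(1,3) this]
  obtain x where x: "x \<in> K" "\<And>y. y \<in> K \<Longrightarrow> norm (F x - x) \<le> norm (F y - y)"
    by blast
  have "norm (F x - x) \<le> 0"
  proof (rule dense_ge)
    fix e :: real assume "0 < e"
    then show "norm (F x - x) \<le> e" using small x(2) by (meson order_trans)
  qed
  then show ?thesis using that x(1) by simp
qed

section \<open>Balls in finite-dimensional subspaces\<close>

lemma closed_if_compact_balls:
  fixes S :: "'a::real_normed_vector set"
  assumes "\<And>r. compact (S \<inter> cball 0 r)"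
  shows "closed S"
  unfolding closed_sequential_limits
proof (intro allI impI, elim conjE)
  fix x l assume x: "\<forall>n. x n \<in> S" "x \<longlonglongrightarrow> l"
  obtain r where "\<And>n. norm (x n) \<le> r"
    using convergent_imp_Bseq[of x] x(2) by (auto simp: convergent_def Bseq_def)
  then have "\<forall>n. x n \<in> S \<inter> cball 0 r" using x by auto
  with x(2) show "l \<in> S"
    using compact_imp_closed[OF assms[of r]] unfolding closed_sequential_limits by blast
qed

text \<open>Induction on the spanning set. A new vector \<open>b\<close> outside the closed subspace \<open>span B\<close> has
  positive distance \<open>d\<close> from it, so the \<open>b\<close>-coefficient of \<open>x\<close> is at most \<open>norm x / d\<close>. The ball
  in \<open>span (insert b B)\<close> is thus covered by the continuous image of a product of a
  ball in \<open>span B\<close> and a compact interval.\<close>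
lemma compact_ball_span:
  fixes B :: "'a::real_normed_vector set"
  assumes "finite B"
  shows "compact (span B \<inter> cball 0 r)"
  using assms
proof (induction B arbitrary: r)
  case empty
  have "span {} \<inter> cball 0 r \<subseteq> {0::'a}" by auto
  then show ?case using finite_subset finite_imp_compact by blast
next
  case (insert b B)
  show ?case
  proof (cases "b \<in> span B")
    case True
    then show ?thesis using insert.IH by (simp add: span_redundant)
  next
    case False
    define d where "d = infdist b (span B)"
    have "closed (span B)" by (rule closed_if_compact_balls) (rule insert.IH)
    then have d: "d > 0"
      unfolding d_def using False in_closed_iff_infdist_zero[of "span B" b] span_zero
      by (metis empty_iff infdist_nonneg less_le)
    have coeff: "\<bar>k\<bar> * d \<le> norm x" if "x - k *\<^sub>R b \<in> span B" for x k
    proof (cases "k = 0")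
      case False
      have "b - (1/k) *\<^sub>R x = - ((1/k) *\<^sub>R (x - k *\<^sub>R b))" using False by (simp add: algebra_simps)
      also have "\<dots> \<in> span B" using that by (intro span_neg span_scale)
      finally have "d \<le> dist b (b - (1/k) *\<^sub>R x)" unfolding d_def by (rule infdist_le)
      also have "\<dots> = norm x / \<bar>k\<bar>" by (simp add: dist_norm)
      finally show ?thesis using False by (simp add: field_simps)
    qed auto
    define f where "f = (\<lambda>(s, k). s + k *\<^sub>R b)"
    define P where "P = (span B \<inter> cball 0 (r + r / d * norm b)) \<times> {-(r/d)..r/d}"
    have "compact (f ` P)"
      unfolding P_def f_def case_prod_unfold
      by (intro compact_continuous_image compact_Times insert.IH continuous_intros) auto
    moreover have "span (insert b B) \<inter> cball 0 r = f ` P \<inter> cball 0 r"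
    proof (intro equalityI subsetI)
      fix x assume "x \<in> span (insert b B) \<inter> cball 0 r"
      then obtain k where k: "x - k *\<^sub>R b \<in> span B" and x: "norm x \<le> r"
        by (auto simp: span_breakdown_eq)
      have "\<bar>k\<bar> * d \<le> r" using coeff[OF k] x by simp
      then have kr: "\<bar>k\<bar> \<le> r / d" using d by (simp add: field_simps)
      have "norm (x - k *\<^sub>R b) \<le> norm x + \<bar>k\<bar> * norm b"
        using norm_triangle_ineq4[of x "k *\<^sub>R b"] by simp
      also have "\<dots> \<le> r + r / d * norm b" using kr x by (intro add_mono mult_right_mono) auto
      finally have "(x - k *\<^sub>R b, k) \<in> P" using k kr by (auto simp: P_def)
      then show "x \<in> f ` P \<inter> cball 0 r" using x by (force simp: f_def)
    next
      fix x assume "x \<in> f ` P \<inter> cball 0 r"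
      then show "x \<in> span (insert b B) \<inter> cball 0 r"
        by (auto simp: f_def P_def intro!: span_add span_scale intro: span_base span_mono[THEN subsetD, of B])
    qed
    ultimately show ?thesis by (simp add: compact_Int_closed)
  qed
qed

section \<open>Intersection and transversality of the perturbed graphs\<close>

text \<open>The map \<open>f\<close> shrinks the radius \<open>r / 2\<close> to \<open>c * (r / 2)\<close>, and the distance allowed between \<open>f\<close>
  and \<open>g\<close> is exactly what is left over.\<close>
lemma perturbed_graph_half_ball:
  fixes f g :: "'a::real_normed_vector \<Rightarrow> 'b::real_normed_vector"
  assumes "0 \<in> S" "f 0 = 0" "L-lipschitz_on S f" "L \<le> c"
    and "y \<in> S" "norm y \<le> r / 2"
    and "norm (f y - g y) \<le> (1 - c) * (r / 2)"
    and "c \<ge> 0"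
  shows "norm (g y) \<le> r / 2"
proof -
  have "norm (f y) \<le> L * norm y"
    using lipschitz_onD[OF assms(3,5,1)] assms(2) by simp
  also have "\<dots> \<le> c * (r / 2)" using assms by (intro mult_mono) auto
  finally have "norm (f y) + norm (f y - g y) \<le> r / 2"
    using assms(7) by (simp add: algebra_simps)
  moreover have "norm (g y) \<le> norm (f y) + norm (f y - g y)"
    using norm_triangle_ineq4[of "f y" "f y - g y"] by simp
  ultimately show ?thesis by linarith
qed

text \<open>Recentring \<open>f\<close> at \<open>y\<close> and \<open>g\<close> at \<open>x\<close> changes neither the graphs nor the Lipschitz constants, and
  makes both maps vanish at 0. As \<open>y\<close> and \<open>x\<close> lie in open balls, the recentred maps are defined near 0.\<close>
lemma L_transversal_at_common_point:
  fixes X1 X2 :: "'a::banach set"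
  assumes X: "closed_complements X1 X2"
    and f: "f \<in> subspace_ball X1 r \<rightarrow> X2" and Lf: "Lf-lipschitz_on (subspace_ball X1 r) f" "Lf < 1"
    and g: "g \<in> subspace_ball X2 r \<rightarrow> X1" and Lg: "Lg-lipschitz_on (subspace_ball X2 r) g" "Lg < 1"
    and y: "y \<in> subspace_ball X1 r" and x: "x \<in> subspace_ball X2 r"
    and fix_eqs: "f y = x" "g x = y"
  shows "L_transversal {z + y + f y | y. y \<in> subspace_ball X1 r}
           {z + g x + x | x. x \<in> subspace_ball X2 r} (z + y + x)"
proof -
  define \<rho> where "\<rho> = min (r - norm y) (r - norm x)"
  have sub: "subspace X1" "subspace X2" using X by (auto simp: closed_complements_def)
  have \<rho>: "\<rho> > 0" using x y by (auto simp: \<rho>_def subspace_ball_def)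
  have shift1: "y + \<xi> \<in> subspace_ball X1 r" if "\<xi> \<in> subspace_ball X1 \<rho>" for \<xi>
    using that y sub norm_triangle_ineq[of y \<xi>] by (auto simp: subspace_ball_def \<rho>_def subspace_add)
  have shift2: "x + \<eta> \<in> subspace_ball X2 r" if "\<eta> \<in> subspace_ball X2 \<rho>" for \<eta>
    using that x sub norm_triangle_ineq[of x \<eta>] by (auto simp: subspace_ball_def \<rho>_def subspace_add)
  define \<alpha> where "\<alpha> \<xi> = f (y + \<xi>) - f y" for \<xi>
  define \<beta> where "\<beta> \<eta> = g (x + \<eta>) - g x" for \<eta>
  have "\<alpha> \<in> subspace_ball X1 \<rho> \<rightarrow> X2"
    using f shift1 y sub by (auto simp: \<alpha>_def Pi_iff subspace_diff)
  moreover have "\<beta> \<in> subspace_ball X2 \<rho> \<rightarrow> X1"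
    using g shift2 x sub by (auto simp: \<beta>_def Pi_iff subspace_diff)
  moreover have "Lf-lipschitz_on (subspace_ball X1 \<rho>) \<alpha>"
    using Lf(1) lipschitz_onD[OF Lf(1) shift1 shift1]
    by (auto simp: lipschitz_on_def \<alpha>_def dist_norm)
  moreover have "Lg-lipschitz_on (subspace_ball X2 \<rho>) \<beta>"
    using Lg(1) lipschitz_onD[OF Lg(1) shift2 shift2]
    by (auto simp: lipschitz_on_def \<beta>_def dist_norm)
  moreover have "{z + y + x + \<xi> + \<alpha> \<xi> | \<xi>. \<xi> \<in> subspace_ball X1 \<rho>}
      \<subseteq> {z + y + f y | y. y \<in> subspace_ball X1 r}"
  proof clarify
    fix \<xi> assume "\<xi> \<in> subspace_ball X1 \<rho>"
    moreover have "z + y + x + \<xi> + \<alpha> \<xi> = z + (y + \<xi>) + f (y + \<xi>)" by (simp add: \<alpha>_def fix_eqs)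
    ultimately show "\<exists>v. z + y + x + \<xi> + \<alpha> \<xi> = z + v + f v \<and> v \<in> subspace_ball X1 r"
      using shift1 by blast
  qed
  moreover have "{z + y + x + \<beta> \<eta> + \<eta> | \<eta>. \<eta> \<in> subspace_ball X2 \<rho>}
      \<subseteq> {z + g x + x | x. x \<in> subspace_ball X2 r}"
  proof clarify
    fix \<eta> assume "\<eta> \<in> subspace_ball X2 \<rho>"
    moreover have "z + y + x + \<beta> \<eta> + \<eta> = z + g (x + \<eta>) + (x + \<eta>)" by (simp add: \<beta>_def fix_eqs)
    ultimately show "\<exists>v. z + y + x + \<beta> \<eta> + \<eta> = z + g v + v \<and> v \<in> subspace_ball X2 r"
      using shift2 by blast
  qed
  moreover have "\<alpha> 0 = 0" "\<beta> 0 = 0" by (simp_all add: \<alpha>_def \<beta>_def)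
  moreover have "z + y + x \<in> {z + y + f y | y. y \<in> subspace_ball X1 r} \<inter>
      {z + g x + x | x. x \<in> subspace_ball X2 r}"
    using x y fix_eqs by (auto intro: exI[of _ x] exI[of _ y])
  ultimately show ?thesis
    unfolding L_transversal_def using X \<rho> Lf(2) Lg(2) by blast
qed

theorem proposition7p2:
  fixes X1 X2 M N Mt Nt :: "'a::banach set"
    and \<theta> \<theta>t \<sigma> \<sigma>t :: "'a \<Rightarrow> 'a"
    and z :: 'a
    and r c L\<theta> L\<sigma> :: real
  assumes "closed_complements X1 X2"
    and "r > 0"
    and "\<theta> \<in> subspace_ball X1 r \<rightarrow> X2"
    and "\<theta>t \<in> subspace_ball X1 r \<rightarrow> X2"
    and "\<sigma> \<in> subspace_ball X2 r \<rightarrow> X1"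
    and "\<sigma>t \<in> subspace_ball X2 r \<rightarrow> X1"
    and "\<theta> 0 = 0" and "\<sigma> 0 = 0"
    and "L\<theta>-lipschitz_on (subspace_ball X1 r) \<theta>" and "L\<theta> < 1"
    and "L\<sigma>-lipschitz_on (subspace_ball X2 r) \<sigma>" and "L\<sigma> < 1"
    and "M = {y + \<theta> y | y. y \<in> subspace_ball X1 r}"
    and "N = {\<sigma> x + x | x. x \<in> subspace_ball X2 r}"
    and "Mt = {z + y + \<theta>t y | y. y \<in> subspace_ball X1 r}"
    and "Nt = {z + \<sigma>t x + x | x. x \<in> subspace_ball X2 r}"
    and "0 < c" and "c < 1" and "L\<theta> \<le> c" and "L\<sigma> \<le> c"
    and "\<forall>y\<in>subspace_ball X1 r. norm (\<theta> y - \<theta>t y) \<le> (1 - c) * (r / 2)"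
    and "\<forall>x\<in>subspace_ball X2 r. norm (\<sigma> x - \<sigma>t x) \<le> (1 - c) * (r / 2)"
  shows "(finite_dim X1 \<and> continuous_on (subspace_ball X1 r) \<theta>t \<and>
              continuous_on (subspace_ball X2 r) \<sigma>t
          \<or> (\<exists>L\<theta>t L\<sigma>t. L\<theta>t-lipschitz_on (subspace_ball X1 r) \<theta>t \<and>
              L\<sigma>t-lipschitz_on (subspace_ball X2 r) \<sigma>t \<and> L\<theta>t * L\<sigma>t < 1)
          \<longrightarrow> Mt \<inter> Nt \<noteq> {})
       \<and> ((\<exists>L\<theta>t<1. L\<theta>t-lipschitz_on (subspace_ball X1 r) \<theta>t) \<and>
          (\<exists>L\<sigma>t<1. L\<sigma>t-lipschitz_on (subspace_ball X2 r) \<sigma>t)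
          \<longrightarrow> (\<exists>y0. L_transversal Mt Nt y0))"
proof -
  have sub: "subspace X1" "subspace X2" and cl: "closed X1"
    using assms(1) by (auto simp: closed_complements_def)
  define K where "K = X1 \<inter> cball 0 (r / 2)"
  define F where "F y = \<sigma>t (\<theta>t y)" for y
  have half1: "\<theta>t y \<in> X2 \<inter> cball 0 (r / 2)" if "y \<in> K" for y
  proof -
    have y: "y \<in> subspace_ball X1 r" "norm y \<le> r / 2"
      using that \<open>r > 0\<close> by (auto simp: K_def subspace_ball_def)
    have "norm (\<theta>t y) \<le> r / 2"
      by (rule perturbed_graph_half_ball[where S = "subspace_ball X1 r" and f = \<theta> and L = L\<theta> and c = c])
         (use assms y sub in \<open>auto simp: subspace_ball_def subspace_0\<close>)
    then show ?thesis using assms(4) y by auto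
  qed
  have half2: "\<sigma>t x \<in> K" if "x \<in> X2 \<inter> cball 0 (r / 2)" for x
  proof -
    have x: "x \<in> subspace_ball X2 r" "norm x \<le> r / 2"
      using that \<open>r > 0\<close> by (auto simp: subspace_ball_def)
    have "norm (\<sigma>t x) \<le> r / 2"
      by (rule perturbed_graph_half_ball[where S = "subspace_ball X2 r" and f = \<sigma> and L = L\<sigma> and c = c])
         (use assms x sub in \<open>auto simp: subspace_ball_def subspace_0\<close>)
    then show ?thesis using assms(6) x by (auto simp: K_def)
  qed
  have F: "F \<in> K \<rightarrow> K" using half1 half2 by (auto simp: F_def)
  have K_sub: "K \<subseteq> subspace_ball X1 r" and K2_sub: "X2 \<inter> cball 0 (r / 2) \<subseteq> subspace_ball X2 r"
    using \<open>r > 0\<close> by (auto simp: K_def subspace_ball_def)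
  have "0 \<in> K" using sub \<open>r > 0\<close> by (simp add: K_def subspace_0)
  then have K0: "K \<noteq> {}" by blast
  have fixed_finite_dim: "\<exists>y\<in>K. F y = y"
    if "finite_dim X1" "continuous_on (subspace_ball X1 r) \<theta>t" "continuous_on (subspace_ball X2 r) \<sigma>t"
  proof -
    have "compact K" using that(1) compact_ball_span unfolding finite_dim_def K_def by blast
    moreover have "convex K" unfolding K_def using sub by (intro convex_Int subspace_imp_convex convex_cball)
    moreover have "continuous_on K F"
      unfolding F_def
      by (rule continuous_on_compose2[OF that(3) continuous_on_subset[OF that(2) K_sub]])
         (use half1 K2_sub in blast)
    ultimately show ?thesis using schauder_fixed_point[OF _ _ K0 _ F] by metis
  qed
  have fixed_lipschitz: "\<exists>y\<in>K. F y = y"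
    if L: "L1-lipschitz_on (subspace_ball X1 r) \<theta>t" "L2-lipschitz_on (subspace_ball X2 r) \<sigma>t" "L1 * L2 < 1"
    for L1 L2
  proof -
    have "L1-lipschitz_on K \<theta>t" using L(1) K_sub by (rule lipschitz_on_subset)
    moreover have "L2-lipschitz_on (\<theta>t ` K) \<sigma>t"
      using half1 K2_sub by (intro lipschitz_on_subset[OF L(2)]) blast
    ultimately have "(L2 * L1)-lipschitz_on K F"
      unfolding F_def by (rule lipschitz_on_compose2)
    then have "\<exists>!y\<in>K. F y = y"
      using F L(3) K0 cl by (intro Banach_fix[where c = "L2 * L1"])
        (auto simp: lipschitz_on_def mult.commute K_def complete_eq_closed)
    then show ?thesis by blast
  qed
  have common: "\<exists>y\<in>subspace_ball X1 r. \<exists>x\<in>subspace_ball X2 r. \<theta>t y = x \<and> \<sigma>t x = y"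
    if "\<exists>y\<in>K. F y = y"
    using that half1 K_sub K2_sub unfolding F_def by blast
  show ?thesis
  proof (intro conjI impI)
    assume "finite_dim X1 \<and> continuous_on (subspace_ball X1 r) \<theta>t \<and> continuous_on (subspace_ball X2 r) \<sigma>t
          \<or> (\<exists>L\<theta>t L\<sigma>t. L\<theta>t-lipschitz_on (subspace_ball X1 r) \<theta>t \<and>
              L\<sigma>t-lipschitz_on (subspace_ball X2 r) \<sigma>t \<and> L\<theta>t * L\<sigma>t < 1)"
    then have "\<exists>y\<in>K. F y = y" using fixed_finite_dim fixed_lipschitz by blast
    then obtain y x where yx: "y \<in> subspace_ball X1 r" "x \<in> subspace_ball X2 r" "\<theta>t y = x" "\<sigma>t x = y"
      using common by blast
    then have "z + y + x = z + y + \<theta>t y" "z + y + x = z + \<sigma>t x + x" by simp_all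
    then have "z + y + x \<in> Mt" "z + y + x \<in> Nt"
      unfolding assms(15,16) using yx(1,2) by blast+
    then show "Mt \<inter> Nt \<noteq> {}" by blast
  next
    assume "(\<exists>L\<theta>t<1. L\<theta>t-lipschitz_on (subspace_ball X1 r) \<theta>t) \<and>
          (\<exists>L\<sigma>t<1. L\<sigma>t-lipschitz_on (subspace_ball X2 r) \<sigma>t)"
    then obtain L1 L2 where L: "L1-lipschitz_on (subspace_ball X1 r) \<theta>t" "L1 < 1"
        "L2-lipschitz_on (subspace_ball X2 r) \<sigma>t" "L2 < 1" by blast
    have "L1 * L2 < 1"
      using L lipschitz_on_nonneg[OF L(1)] lipschitz_on_nonneg[OF L(3)]
      by (meson less_imp_le mult_left_le_one_le order.strict_trans1)
    then obtain y x where yx: "y \<in> subspace_ball X1 r" "x \<in> subspace_ball X2 r" "\<theta>t y = x" "\<sigma>t x = y"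
      using common fixed_lipschitz L by blast
    show "\<exists>y0. L_transversal Mt Nt y0"
      unfolding assms(15,16)
      using L_transversal_at_common_point[OF assms(1,4) L(1,2) assms(6) L(3,4) yx] by blast
  qed
qed

end
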